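(* Let $\vec C$ be an orientation of the cycle $C_4$. If $G$ is a graph with $m(G)<m_2(C_4)$, then $G\not\to\vec C$, i.e., $G$ has an orientation containing no copy of $\vec C$.
   Context: $m(G)=\max\{e(J)/v(J):J\subseteq G,\ v(J)\ge1\}$ and $m_2(G)=\max\{(e(J)-1)/(v(J)-2):J\subseteq G,\ v(J)\ge3\}$; in particular $m_2(C_4)=3/2$. *)

theory Defs
  imports Complex_Main
begin

record 'a ugraph =
  uverts :: "'a set"
  uedges :: "'a set set"

definition fin_simple_graph :: "'a ugraph \<Rightarrow> bool" where
  "fin_simple_graph G \<longleftrightarrow>
     finite (uverts G) \<and> (\<forall>e\<in>uedges G. e \<subseteq> uverts G \<and> card e = 2)"

definition is_subgraph :: "'a ugraph \<Rightarrow> 'a ugraph \<Rightarrow> bool" where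
  "is_subgraph J G \<longleftrightarrow>
     fin_simple_graph J \<and> uverts J \<subseteq> uverts G \<and> uedges J \<subseteq> uedges G"

definition max_density :: "'a ugraph \<Rightarrow> real" where
  "max_density G =
     Max {real (card (uedges J)) / real (card (uverts J)) | J.
            is_subgraph J G \<and> card (uverts J) \<ge> 1}"

definition max_2_density :: "'a ugraph \<Rightarrow> real" where
  "max_2_density G =
     Max {(real (card (uedges J)) - 1) / (real (card (uverts J)) - 2) | J.
            is_subgraph J G \<and> card (uverts J) \<ge> 3}"

text \<open>For \<open>n \<ge> 3\<close> this is the cycle of length \<open>n\<close>; smaller values of \<open>n\<close> are degenerate.\<close>

definition cycle_graph :: "nat \<Rightarrow> nat ugraph" where
  "cycle_graph n =
     \<lparr>uverts = {0..<n}, uedges = {{i, Suc i mod n} | i. i < n}\<rparr>"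

record 'a dgraph =
  dverts :: "'a set"
  darcs :: "('a \<times> 'a) set"

definition is_orientation :: "'a dgraph \<Rightarrow> 'a ugraph \<Rightarrow> bool" where
  "is_orientation D G \<longleftrightarrow>
     dverts D = uverts G \<and>
     (\<forall>u v. {u, v} \<in> uedges G \<longleftrightarrow> (u, v) \<in> darcs D \<or> (v, u) \<in> darcs D) \<and>
     (\<forall>u v. \<not> ((u, v) \<in> darcs D \<and> (v, u) \<in> darcs D))"

definition is_subdigraph :: "'a dgraph \<Rightarrow> 'a dgraph \<Rightarrow> bool" where
  "is_subdigraph K D \<longleftrightarrow>
     dverts K \<subseteq> dverts D \<and> darcs K \<subseteq> darcs D \<and> darcs K \<subseteq> dverts K \<times> dverts K"

definition digraph_isomorphic :: "'b dgraph \<Rightarrow> 'a dgraph \<Rightarrow> bool" where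
  "digraph_isomorphic H K \<longleftrightarrow>
     (\<exists>f. bij_betw f (dverts H) (dverts K) \<and>
          (\<forall>u\<in>dverts H. \<forall>v\<in>dverts H. (u, v) \<in> darcs H \<longleftrightarrow> (f u, f v) \<in> darcs K))"

text \<open>Copies are subdigraphs, not necessarily induced.\<close>

definition contains_copy :: "'a dgraph \<Rightarrow> 'b dgraph \<Rightarrow> bool" where
  "contains_copy D H \<longleftrightarrow> (\<exists>K. is_subdigraph K D \<and> digraph_isomorphic H K)"

definition orientation_arrow :: "'a ugraph \<Rightarrow> 'b dgraph \<Rightarrow> bool" where
  "orientation_arrow G H \<longleftrightarrow> (\<forall>D. is_orientation D G \<longrightarrow> contains_copy D H)"

end

theory Submission
  imports Defs
begin

text \<open>
  The bound \<open>m(G) < 3/2\<close> forces every nonempty induced subgraph to have a vertex of degree at most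
  two, so \<open>G\<close> can be built by adding vertices one at a time with at most two earlier neighbours.
  Every orientation of \<open>C\<^sub>4\<close> contains a directed path with three arcs, or consists of two directed
  paths of length two with common ends, or is alternating.
  For a path with three arcs, take a proper 3-colouring of \<open>G\<close> and orient every edge towards its
  larger colour.  An alternating cycle is avoided by giving each new vertex with two earlier
  neighbours one in-arc and one out-arc.  For two parallel paths, each new vertex is made a source
  or a sink: if both choices closed a copy, the two vertices opposite to the new one would
  already form a copy together with its two neighbours.
\<close>

section \<open>Densities\<close>

lemma finite_uedges:
  assumes "fin_simple_graph G"
  shows "finite (uedges G)"
proof (rule finite_subset)
  show "uedges G \<subseteq> Pow (uverts G)"
    using assms by (auto simp: fin_simple_graph_def)
  show "finite (Pow (uverts G))"
    using assms by (simp add: fin_simple_graph_def)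
qed

text \<open>\<open>Max\<close> is only meaningful on finite sets. A subgraph is determined by a pair
  of subsets of the finite vertex and edge sets, so only finitely many densities occur.\<close>

lemma finite_subgraphs:
  assumes "fin_simple_graph G"
  shows "finite {J. is_subgraph J G}"
proof (rule finite_subset)
  show "{J. is_subgraph J G} \<subseteq>
    (\<lambda>(V, E). \<lparr>uverts = V, uedges = E\<rparr>) ` (Pow (uverts G) \<times> Pow (uedges G))"
  proof
    fix J assume "J \<in> {J. is_subgraph J G}"
    then have "(uverts J, uedges J) \<in> Pow (uverts G) \<times> Pow (uedges G)"
      by (auto simp: is_subgraph_def)
    then show "J \<in> (\<lambda>(V, E). \<lparr>uverts = V, uedges = E\<rparr>) ` (Pow (uverts G) \<times> Pow (uedges G))"
      by (rule rev_image_eqI) simp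
  qed
  show "finite ((\<lambda>(V, E). \<lparr>uverts = V, uedges = E\<rparr>) ` (Pow (uverts G) \<times> Pow (uedges G)))"
    using assms finite_uedges[OF assms] by (simp add: fin_simple_graph_def)
qed

lemma density_le_max_density:
  assumes "fin_simple_graph G" "is_subgraph J G" "card (uverts J) \<ge> 1"
  shows "real (card (uedges J)) / real (card (uverts J)) \<le> max_density G"
  unfolding max_density_def
proof (rule Max_ge)
  have "finite ((\<lambda>J. real (card (uedges J)) / real (card (uverts J))) ` {J. is_subgraph J G})"
    using finite_subgraphs[OF assms(1)] by simp
  then show "finite {real (card (uedges J)) / real (card (uverts J)) | J.
      is_subgraph J G \<and> card (uverts J) \<ge> 1}"
    by (rule rev_finite_subset) auto
qed (use assms in auto)

section \<open>The 2-density of the 4-cycle\<close>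

lemma uedges_cycle_graph_4:
  "uedges (cycle_graph 4) = {{0, 1}, {1, 2}, {2, 3}, {3, 0}}"
proof -
  have succ: "Suc 0 mod 4 = 1" "Suc 1 mod 4 = 2" "Suc 2 mod 4 = 3" "Suc 3 mod 4 = 0"
    by simp_all
  have "uedges (cycle_graph 4) = (\<lambda>i. {i, Suc i mod 4}) ` {i. i < 4}"
    by (auto simp: cycle_graph_def)
  also have "{i::nat. i < 4} = {0, 1, 2, 3}"
    by auto
  also have "(\<lambda>i. {i, Suc i mod 4}) ` {0, 1, 2, 3} = {{0, 1}, {1, 2}, {2, 3}, {3, 0}}"
    by (simp only: image_insert image_empty succ)
  finally show ?thesis .
qed

lemma uverts_cycle_graph_4: "uverts (cycle_graph 4) = {0, 1, 2, 3}"
  by (auto simp: cycle_graph_def)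

lemma fin_simple_graph_cycle_graph_4: "fin_simple_graph (cycle_graph 4)"
  by (auto simp: fin_simple_graph_def uedges_cycle_graph_4 uverts_cycle_graph_4)

text \<open>Four vertices carry at most four edges, giving (4-1)/(4-2) = 3/2; dropping a vertex also
  drops its two edges, leaving at most (2-1)/(3-2) = 1. This bound turns the hypothesis of the
  theorem into \<open>max_density G < 3/2\<close>.\<close>

lemma max_2_density_cycle_graph_4_le: "max_2_density (cycle_graph 4) \<le> 3/2"
proof -
  let ?C = "cycle_graph 4"
  let ?d = "\<lambda>J::nat ugraph. (real (card (uedges J)) - 1) / (real (card (uverts J)) - 2)"
  let ?S = "{?d J | J. is_subgraph J ?C \<and> card (uverts J) \<ge> 3}"
  have "finite (?d ` {J. is_subgraph J ?C})"
    using finite_subgraphs[OF fin_simple_graph_cycle_graph_4] by simp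
  then have fin: "finite ?S"
    by (rule rev_finite_subset) auto
  have "is_subgraph ?C ?C" "card (uverts ?C) \<ge> 3"
    using fin_simple_graph_cycle_graph_4 by (auto simp: is_subgraph_def uverts_cycle_graph_4)
  then have ne: "?S \<noteq> {}"
    by blast
  have "?d J \<le> 3/2" if J: "is_subgraph J ?C" "card (uverts J) \<ge> 3" for J
  proof -
    have V: "uverts J \<subseteq> {0, 1, 2, 3}" and E: "uedges J \<subseteq> {{0, 1}, {1, 2}, {2, 3}, {3, 0}}"
      using J(1) unfolding is_subgraph_def uedges_cycle_graph_4 uverts_cycle_graph_4
      by simp_all
    have EV: "e \<subseteq> uverts J" if "e \<in> uedges J" for e
      using J(1) that by (simp add: is_subgraph_def fin_simple_graph_def)
    show ?thesis
    proof (cases "uverts J = {0, 1, 2, 3}")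
      case True
      have "card (uedges J) \<le> card {{0::nat, 1}, {1, 2}, {2, 3}, {3, 0}}"
        by (rule card_mono[OF _ E]) simp
      also have "\<dots> \<le> 4"
        using card_length[of "[{0::nat, 1}, {1, 2}, {2, 3}, {3, 0}]"] by simp
      finally show ?thesis
        by (simp add: True)
    next
      case False
      then obtain w where w: "w \<in> {0, 1, 2, 3}" "w \<notin> uverts J"
        using V by auto
      have "card (uverts J) \<le> card ({0::nat, 1, 2, 3} - {w})"
        using V w by (intro card_mono) auto
      also have "\<dots> = 3"
        using w by auto
      finally have cV: "card (uverts J) = 3"
        using J by simp
      \<comment> \<open>Each vertex of the cycle lies on two of its four edges, so only the other
        two can survive without \<open>w\<close>.\<close>
      have "\<exists>e f. uedges J \<subseteq> {e, f}"
        using w(1)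
      proof (elim insertE emptyE)
        assume "w = 0"
        then have "uedges J \<subseteq> {{1, 2}, {2, 3}}" using E EV w(2) by blast
        then show ?thesis by blast
      next
        assume "w = 1"
        then have "uedges J \<subseteq> {{2, 3}, {3, 0}}" using E EV w(2) by blast
        then show ?thesis by blast
      next
        assume "w = 2"
        then have "uedges J \<subseteq> {{0, 1}, {3, 0}}" using E EV w(2) by blast
        then show ?thesis by blast
      next
        assume "w = 3"
        then have "uedges J \<subseteq> {{0, 1}, {1, 2}}" using E EV w(2) by blast
        then show ?thesis by blast
      qed
      then obtain e f where "uedges J \<subseteq> {e, f}"
        by blast
      then have "card (uedges J) \<le> card {e, f}"
        by (intro card_mono) auto
      also have "\<dots> \<le> 2"
        by (simp add: card_insert_if)
      finally show ?thesis
        by (simp add: cV)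
    qed
  qed
  then show ?thesis
    unfolding max_2_density_def using Max.boundedI[OF fin ne] by blast
qed

section \<open>Degeneracy\<close>

text \<open>Double counting: if all degrees inside \<open>W\<close> were at least 3, the subgraph
  induced on \<open>W\<close> would have at least 3/2 times as many edges as vertices.\<close>

lemma exists_degree_le_2:
  assumes G: "fin_simple_graph G" and dens: "max_density G < 3/2"
    and W: "W \<subseteq> uverts G" "W \<noteq> {}"
  shows "\<exists>v\<in>W. card {u \<in> W. {u, v} \<in> uedges G} \<le> 2"
proof (rule ccontr)
  assume "\<not> ?thesis"
  then have deg: "card {u \<in> W. {u, v} \<in> uedges G} \<ge> 3" if "v \<in> W" for v
    using that by force
  define F where "F = {e \<in> uedges G. e \<subseteq> W}"
  have finW: "finite W"
    using G W(1) by (auto simp: fin_simple_graph_def intro: finite_subset)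
  have finF: "finite F"
    using finite_uedges[OF G] by (simp add: F_def)
  have cardF: "card e = 2" if "e \<in> F" for e
    using G that by (auto simp: F_def fin_simple_graph_def)
  have inc: "card {u \<in> W. {u, v} \<in> uedges G} \<le> card {e \<in> F. v \<in> e}" if "v \<in> W" for v
  proof (rule card_inj_on_le)
    show "inj_on (\<lambda>u. {u, v}) {u \<in> W. {u, v} \<in> uedges G}"
      by (auto simp: inj_on_def doubleton_eq_iff)
    show "(\<lambda>u. {u, v}) ` {u \<in> W. {u, v} \<in> uedges G} \<subseteq> {e \<in> F. v \<in> e}"
      using that by (auto simp: F_def)
    show "finite {e \<in> F. v \<in> e}"
      using finF by simp
  qed
  have "3 * card W = (\<Sum>v\<in>W. 3)"
    by simp
  also have "\<dots> \<le> (\<Sum>v\<in>W. card {e \<in> F. v \<in> e})"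
    using deg inc by (intro sum_mono) (meson order_trans)
  also have "\<dots> = 2 * card F"
  proof (rule sum_multicount[OF finW finF])
    have "{v \<in> W. v \<in> e} = e" if "e \<in> F" for e
      using that by (auto simp: F_def)
    then show "\<forall>e\<in>F. card {v \<in> W. v \<in> e} = 2"
      using cardF by simp
  qed
  finally have le: "3 * card W \<le> 2 * card F" .
  have pos: "card W \<ge> 1"
    using finW W(2) by (simp add: Suc_le_eq card_gt_0_iff)
  have "is_subgraph \<lparr>uverts = W, uedges = F\<rparr> G"
    using finW W(1) cardF by (auto simp: is_subgraph_def fin_simple_graph_def F_def)
  then have "real (card F) / real (card W) \<le> max_density G"
    using density_le_max_density[OF G, of "\<lparr>uverts = W, uedges = F\<rparr>"] pos by simp
  with dens have "real (card F) / real (card W) < 3/2"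
    by linarith
  then show False
    using le pos by (simp add: field_simps)
qed

text \<open>Peel off a vertex of degree at most \<open>k\<close>, treat the rest by induction, and
  put the vertex back. The claim is proved for all subsets of \<open>V\<close>, since the low-degree
  vertex has to be found anew in each remaining set.\<close>

lemma degenerate_induct [consumes 2, case_names empty insert]:
  assumes fin: "finite V"
    and deg: "\<forall>W\<subseteq>V. W \<noteq> {} \<longrightarrow> (\<exists>v\<in>W. card {u \<in> W. {u, v} \<in> E} \<le> k)"
    and empty: "P {}"
    and insert: "\<And>W v. W \<subseteq> V \<Longrightarrow> v \<in> V \<Longrightarrow> v \<notin> W \<Longrightarrow> card {u \<in> W. {u, v} \<in> E} \<le> k \<Longrightarrow>
      P W \<Longrightarrow> P (insert v W)"
  shows "P V"
proof -
  have "P W" if "W \<subseteq> V" for W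
    using finite_subset[OF that fin] that
  proof (induction rule: finite_psubset_induct)
    case (psubset W)
    show ?case
    proof (cases "W = {}")
      case False
      then obtain v where v: "v \<in> W" "card {u \<in> W. {u, v} \<in> E} \<le> k"
        using deg psubset.prems by blast
      have "card {u \<in> W - {v}. {u, v} \<in> E} \<le> card {u \<in> W. {u, v} \<in> E}"
        using psubset.hyps by (intro card_mono) auto
      then have "P (insert v (W - {v}))"
        using v psubset by (intro insert) auto
      with v(1) show ?thesis
        by (simp add: insert_absorb)
    qed (simp add: empty)
  qed
  then show ?thesis
    by simp
qed

section \<open>Extending orientations by one vertex\<close>

text \<open>A version of \<open>is_orientation\<close> relative to a vertex set: \<open>E\<close>
  stays the full edge set while \<open>W\<close> grows, hence the quantifiers bounded by
  \<open>W\<close>.\<close>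

definition orients :: "'a set set \<Rightarrow> 'a set \<Rightarrow> ('a \<times> 'a) set \<Rightarrow> bool" where
  "orients E W A \<longleftrightarrow> A \<subseteq> W \<times> W \<and>
     (\<forall>u\<in>W. \<forall>v\<in>W. {u, v} \<in> E \<longleftrightarrow> (u, v) \<in> A \<or> (v, u) \<in> A) \<and>
     (\<forall>u v. \<not> ((u, v) \<in> A \<and> (v, u) \<in> A))"

text \<open>The condition \<open>b \<noteq> d\<close> keeps the two paths from \<open>a\<close> to
  \<open>c\<close> from coinciding; \<open>a\<close> and \<open>c\<close> differ automatically when
  no two arcs are opposite.\<close>

definition parallel_paths :: "('a \<times> 'a) set \<Rightarrow> 'a \<Rightarrow> 'a \<Rightarrow> 'a \<Rightarrow> 'a \<Rightarrow> bool" where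
  "parallel_paths A a b c d \<longleftrightarrow>
     b \<noteq> d \<and> (a, b) \<in> A \<and> (b, c) \<in> A \<and> (a, d) \<in> A \<and> (d, c) \<in> A"

text \<open>The sources are \<open>a\<close> and \<open>c\<close>, the sinks \<open>b\<close> and
  \<open>d\<close>. If either pair coincided, the four arcs would collapse to at most two.\<close>

definition alternating_cycle :: "('a \<times> 'a) set \<Rightarrow> 'a \<Rightarrow> 'a \<Rightarrow> 'a \<Rightarrow> 'a \<Rightarrow> bool" where
  "alternating_cycle A a b c d \<longleftrightarrow>
     a \<noteq> c \<and> b \<noteq> d \<and> (a, b) \<in> A \<and> (c, b) \<in> A \<and> (c, d) \<in> A \<and> (a, d) \<in> A"

text \<open>Here \<open>I\<close> and \<open>O'\<close> split the neighbours of \<open>v\<close>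
  into in- and out-neighbours. All new arcs meet \<open>v\<close>, which lies outside
  \<open>W\<close>, so they cannot conflict with \<open>A\<close>.\<close>

lemma orients_insert:
  assumes "orients E W A" "v \<notin> W" "\<forall>e\<in>E. card e = 2"
    and "I \<inter> O' = {}" "I \<union> O' = {u \<in> W. {u, v} \<in> E}"
  shows "orients E (insert v W) (A \<union> I \<times> {v} \<union> {v} \<times> O')"
proof -
  have loop: "{u, u} \<notin> E" for u
    using assms(3) by force
  have nb: "{u, v} \<in> E \<longleftrightarrow> u \<in> I \<or> u \<in> O'" "{v, u} \<in> E \<longleftrightarrow> u \<in> I \<or> u \<in> O'" if "u \<in> W" for u
    using that assms(5) by (auto simp: insert_commute)
  have sub: "I \<subseteq> W" "O' \<subseteq> W"
    using assms(5) by auto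
  have A: "A \<subseteq> W \<times> W" "\<And>x y. (x, y) \<in> A \<Longrightarrow> (y, x) \<notin> A"
    and EA: "\<And>x y. x \<in> W \<Longrightarrow> y \<in> W \<Longrightarrow> {x, y} \<in> E \<longleftrightarrow> (x, y) \<in> A \<or> (y, x) \<in> A"
    using assms(1) by (auto simp: orients_def)
  show ?thesis
    unfolding orients_def
  proof (intro conjI ballI allI)
    show "A \<union> I \<times> {v} \<union> {v} \<times> O' \<subseteq> insert v W \<times> insert v W"
      using A(1) sub by auto
    fix x y
    show "\<not> ((x, y) \<in> A \<union> I \<times> {v} \<union> {v} \<times> O' \<and> (y, x) \<in> A \<union> I \<times> {v} \<union> {v} \<times> O')"
      using A sub assms(2,4) by blast
    assume xy: "x \<in> insert v W" "y \<in> insert v W"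
    then show "{x, y} \<in> E \<longleftrightarrow>
      (x, y) \<in> A \<union> I \<times> {v} \<union> {v} \<times> O' \<or> (y, x) \<in> A \<union> I \<times> {v} \<union> {v} \<times> O'"
    proof (cases "x = v"; cases "y = v")
      assume "x = v" "y = v"
      then show ?thesis using loop A(1) sub assms(2) by auto
    next
      assume "x = v" "y \<noteq> v"
      then show ?thesis using nb xy A(1) sub assms(2) by auto
    next
      assume "x \<noteq> v" "y = v"
      then show ?thesis using nb xy A(1) sub assms(2) by auto
    next
      assume "x \<noteq> v" "y \<noteq> v"
      then show ?thesis using EA xy by auto
    qed
  qed
qed

lemma card_le_2_eq_doubleton:
  assumes "finite N" "card N \<le> 2" "x \<in> N" "y \<in> N" "x \<noteq> y"
  shows "N = {x, y}"
  using card_seteq[OF assms(1), of "{x, y}"] assms by simp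

section \<open>Colourings and orientations of 2-degenerate graphs\<close>

context
  fixes V :: "'a set" and E :: "'a set set"
  assumes fin: "finite V"
    and card_edge: "\<forall>e\<in>E. card e = 2"
    and deg: "\<forall>W\<subseteq>V. W \<noteq> {} \<longrightarrow> (\<exists>v\<in>W. card {u \<in> W. {u, v} \<in> E} \<le> 2)"
begin

text \<open>Greedy colouring: at most two earlier neighbours leave one of three colours
  free.\<close>

lemma ex_3_colouring:
  "\<exists>f :: 'a \<Rightarrow> nat. (\<forall>v. f v < 3) \<and> (\<forall>u\<in>V. \<forall>v\<in>V. {u, v} \<in> E \<longrightarrow> f u \<noteq> f v)"
  using fin deg
proof (induction rule: degenerate_induct)
  case empty
  show ?case by (auto intro: exI[of _ "\<lambda>_. 0"])
next
  case (insert W v)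
  then obtain f :: "'a \<Rightarrow> nat" where f: "\<And>v. f v < 3"
      "\<And>u v. u \<in> W \<Longrightarrow> v \<in> W \<Longrightarrow> {u, v} \<in> E \<Longrightarrow> f u \<noteq> f v"
    by blast
  let ?N = "{u \<in> W. {u, v} \<in> E}"
  have finN: "finite ?N"
    using finite_subset[OF insert(1) fin] by simp
  have "card (f ` ?N) \<le> 2"
    using card_image_le[OF finN, of f] insert(4) by linarith
  moreover have "finite (f ` ?N)"
    using finN by simp
  ultimately have "\<not> {..<3} \<subseteq> f ` ?N"
    using card_mono[of "f ` ?N" "{..<3}"] by auto
  then obtain c where c: "c < 3" "c \<notin> f ` ?N"
    by auto
  have loop: "{v, v} \<notin> E"
    using card_edge by force
  have "f u \<noteq> c" if "u \<in> W" "{u, v} \<in> E \<or> {v, u} \<in> E" for u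
    using c(2) that by (auto simp: insert_commute)
  then have "\<forall>x\<in>insert v W. \<forall>y\<in>insert v W. {x, y} \<in> E \<longrightarrow> (f(v := c)) x \<noteq> (f(v := c)) y"
    using f(2) loop insert(3) by auto
  then show ?case
    using f(1) c(1) by (intro exI[of _ "f(v := c)"]) auto
qed

lemma ex_orients_without_parallel_paths:
  "\<exists>A. orients E V A \<and> (\<forall>a b c d. \<not> parallel_paths A a b c d)"
  using fin deg
proof (induction rule: degenerate_induct)
  case empty
  show ?case by (auto simp: orients_def parallel_paths_def intro: exI[of _ "{}"])
next
  case (insert W v)
  then obtain A where A: "orients E W A" and np: "\<And>a b c d. \<not> parallel_paths A a b c d"
    by blast
  have AW: "A \<subseteq> W \<times> W"
    using A by (simp add: orients_def)
  let ?N = "{u \<in> W. {u, v} \<in> E}"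
  have finN: "finite ?N"
    using finite_subset[OF insert(1) fin] by simp
  have out: "orients E (insert v W) (A \<union> {v} \<times> ?N)"
    using orients_insert[OF A insert(3) card_edge, of "{}" ?N] by simp
  have inn: "orients E (insert v W) (A \<union> ?N \<times> {v})"
    using orients_insert[OF A insert(3) card_edge, of ?N "{}"] by simp
  show ?case
  \<comment> \<open>As a source, \<open>v\<close> can only play the role of \<open>a\<close>. A new
    copy then needs two neighbours of \<open>v\<close> with a common out-neighbour, which is the
    condition tested here.\<close>
  proof (cases "\<exists>x\<in>?N. \<exists>y\<in>?N. \<exists>w. x \<noteq> y \<and> (x, w) \<in> A \<and> (y, w) \<in> A")
    case False
    have "\<not> parallel_paths (A \<union> {v} \<times> ?N) a b c d" for a b c d
      using False np[of a b c d] AW insert(3) unfolding parallel_paths_def by blast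
    with out show ?thesis by blast
  next
    case True
    then obtain x y w where xy: "x \<in> ?N" "y \<in> ?N" "x \<noteq> y" "(x, w) \<in> A" "(y, w) \<in> A"
      by blast
    have N: "?N = {x, y}"
      using card_le_2_eq_doubleton[OF finN insert(4)] xy by blast
    \<comment> \<open>As a sink, \<open>v\<close> can only be \<open>c\<close>, and the middle
      vertices are \<open>x\<close> and \<open>y\<close>. The start \<open>a\<close> would then form
      parallel paths to \<open>w\<close> through \<open>x\<close> and \<open>y\<close>, already
      inside \<open>A\<close>.\<close>
    have "\<not> parallel_paths (A \<union> {x, y} \<times> {v}) a b c d" for a b c d
      using np[of a b c d] np[of a x w y] xy AW insert(3) unfolding parallel_paths_def by blast
    with inn N show ?thesis by auto
  qed
qed

text \<open>A vertex of an alternating cycle has two in-arcs or two out-arcs on it, so a new vertex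
  with at most one of each lies on none.\<close>

lemma ex_orients_without_alternating_cycle:
  "\<exists>A. orients E V A \<and> (\<forall>a b c d. \<not> alternating_cycle A a b c d)"
  using fin deg
proof (induction rule: degenerate_induct)
  case empty
  show ?case by (auto simp: orients_def alternating_cycle_def intro: exI[of _ "{}"])
next
  case (insert W v)
  then obtain A where A: "orients E W A" and na: "\<And>a b c d. \<not> alternating_cycle A a b c d"
    by blast
  have AW: "A \<subseteq> W \<times> W"
    using A by (simp add: orients_def)
  let ?N = "{u \<in> W. {u, v} \<in> E}"
  have finN: "finite ?N"
    using finite_subset[OF insert(1) fin] by simp
  obtain I O' where IO: "I \<inter> O' = {}" "I \<union> O' = ?N"
    and I: "\<And>x y. x \<in> I \<Longrightarrow> y \<in> I \<Longrightarrow> x = y" and O: "\<And>x y. x \<in> O' \<Longrightarrow> y \<in> O' \<Longrightarrow> x = y"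
  proof (cases "\<exists>x\<in>?N. \<exists>y\<in>?N. x \<noteq> y")
    case True
    then obtain x y where "x \<in> ?N" "y \<in> ?N" "x \<noteq> y" by blast
    moreover from this have "?N = {x, y}"
      using card_le_2_eq_doubleton[OF finN insert(4)] by blast
    ultimately show ?thesis
      using that[of "{x}" "{y}"] by auto
  next
    case False
    then show ?thesis
      using that[of ?N "{}"] by blast
  qed
  have sub: "I \<subseteq> W" "O' \<subseteq> W"
    using IO by auto
  have "\<not> alternating_cycle (A \<union> I \<times> {v} \<union> {v} \<times> O') a b c d" for a b c d
    \<comment> \<open>If \<open>v\<close> is a sink of the cycle, both \<open>a\<close> and
      \<open>c\<close> lie in \<open>I\<close>; if it is a source, both \<open>b\<close> and
      \<open>d\<close> lie in \<open>O'\<close>. Either way two distinct vertices would be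
      equal.\<close>
    using na[of a b c d] I[of a c] O[of b d] AW sub insert(3)
    unfolding alternating_cycle_def by blast
  then show ?case
    using orients_insert[OF A insert(3) card_edge IO] by blast
qed

end

section \<open>Copies of an oriented 4-cycle\<close>

text \<open>Reduces a copy to an injective arc-preserving map, the form in which copies are refuted
  below.\<close>

lemma contains_copyE:
  assumes "contains_copy D H"
  obtains f where "inj_on f (dverts H)"
    "\<And>u v. u \<in> dverts H \<Longrightarrow> v \<in> dverts H \<Longrightarrow> (u, v) \<in> darcs H \<Longrightarrow> (f u, f v) \<in> darcs D"
proof -
  from assms obtain K where K: "darcs K \<subseteq> darcs D" "digraph_isomorphic H K"
    by (auto simp: contains_copy_def is_subdigraph_def)
  from K(2) obtain f where "bij_betw f (dverts H) (dverts K)"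
      "\<forall>u\<in>dverts H. \<forall>v\<in>dverts H. (u, v) \<in> darcs H \<longleftrightarrow> (f u, f v) \<in> darcs K"
    unfolding digraph_isomorphic_def by blast
  with K(1) show thesis
    by (intro that[of f]) (auto simp: bij_betw_def)
qed

text \<open>The bounded and unbounded quantifiers agree here because every edge and every arc has
  its ends in \<open>uverts G\<close>.\<close>

lemma is_orientation_of_orients:
  assumes "fin_simple_graph G" "orients (uedges G) (uverts G) A"
  shows "is_orientation \<lparr>dverts = uverts G, darcs = A\<rparr> G"
proof -
  have "u \<in> uverts G" "v \<in> uverts G" if "{u, v} \<in> uedges G" for u v
    using assms(1) that by (auto simp: fin_simple_graph_def)
  moreover have "u \<in> uverts G" "v \<in> uverts G" if "(u, v) \<in> A" for u v
    using assms(2) that by (auto simp: orients_def)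
  ultimately have "{u, v} \<in> uedges G \<longleftrightarrow> (u, v) \<in> A \<or> (v, u) \<in> A" for u v
    using assms(2) unfolding orients_def by metis
  moreover have "\<not> ((u, v) \<in> A \<and> (v, u) \<in> A)" for u v
    using assms(2) by (simp add: orients_def)
  ultimately show ?thesis
    by (simp add: is_orientation_def)
qed

text \<open>Go round the cycle and record the direction of each arc. Three consecutive equal
  directions give \<open>path\<close>, two and two give \<open>parallel\<close>, and strict
  alternation gives \<open>alternating\<close>.\<close>

lemma oriented_4_cycle_cases:
  assumes "is_orientation C (cycle_graph 4)"
  obtains
    (path) p q r s where "{p, q, r, s} \<subseteq> dverts C"
      "(p, q) \<in> darcs C" "(q, r) \<in> darcs C" "(r, s) \<in> darcs C"
  | (parallel) a b c d where "{a, b, c, d} \<subseteq> dverts C" "parallel_paths (darcs C) a b c d"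
  | (alternating) a b c d where "{a, b, c, d} \<subseteq> dverts C" "alternating_cycle (darcs C) a b c d"
proof -
  have V: "dverts C = {0, 1, 2, 3}"
    using assms by (simp add: is_orientation_def uverts_cycle_graph_4)
  have arc: "(u, v) \<in> darcs C \<or> (v, u) \<in> darcs C" if "{u, v} \<in> uedges (cycle_graph 4)" for u v
    using assms that by (simp add: is_orientation_def)
  have e: "(0, 1) \<in> darcs C \<or> (1, 0) \<in> darcs C" "(1, 2) \<in> darcs C \<or> (2, 1) \<in> darcs C"
    "(2, 3) \<in> darcs C \<or> (3, 2) \<in> darcs C" "(3, 0) \<in> darcs C \<or> (0, 3) \<in> darcs C"
    by (rule arc; simp add: uedges_cycle_graph_4)+
  show thesis
  proof (rule ccontr)
    assume "\<not> thesis"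
    then have pth: "\<not> ((p, q) \<in> darcs C \<and> (q, r) \<in> darcs C \<and> (r, s) \<in> darcs C)"
      and par: "\<not> parallel_paths (darcs C) p q r s"
      and alt: "\<not> alternating_cycle (darcs C) p q r s"
      if "{p, q, r, s} \<subseteq> dverts C" for p q r s
      using path[OF that] parallel[OF that] alternating[OF that] by argo+
    note pth' = pth[unfolded V]
    note par' = par[unfolded V parallel_paths_def]
    note alt' = alt[unfolded V alternating_cycle_def]
    show False
      \<comment> \<open>The instances are the eight paths (four starts, two directions), the four
        positions of the source of parallel paths, and the two choices of the pair of sources of an
        alternating cycle.\<close>
      using e[simplified]
        pth'[of 0 1 2 3, simplified] pth'[of 1 2 3 0, simplified]
        pth'[of 2 3 0 1, simplified] pth'[of 3 0 1 2, simplified]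
        pth'[of 3 2 1 0, simplified] pth'[of 0 3 2 1, simplified]
        pth'[of 1 0 3 2, simplified] pth'[of 2 1 0 3, simplified]
        par'[of 0 1 2 3, simplified] par'[of 1 2 3 0, simplified]
        par'[of 2 3 0 1, simplified] par'[of 3 0 1 2, simplified]
        alt'[of 0 1 2 3, simplified] alt'[of 1 2 3 0, simplified]
      by argo
  qed
qed

theorem theorem22:
  fixes G :: "'a ugraph" and C :: "nat dgraph"
  assumes "fin_simple_graph G"
    and "is_orientation C (cycle_graph 4)"
    and "max_density G < max_2_density (cycle_graph 4)"
  shows "\<not> orientation_arrow G C"
proof -
  have dens: "max_density G < 3/2"
    using assms(3) max_2_density_cycle_graph_4_le by linarith
  have fin: "finite (uverts G)" and card_edge: "\<forall>e\<in>uedges G. card e = 2"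
    using assms(1) by (auto simp: fin_simple_graph_def)
  have deg: "\<forall>W\<subseteq>uverts G. W \<noteq> {} \<longrightarrow>
      (\<exists>v\<in>W. card {u \<in> W. {u, v} \<in> uedges G} \<le> 2)"
    using exists_degree_le_2[OF assms(1) dens] by blast
  have "\<exists>D. is_orientation D G \<and> \<not> contains_copy D C"
    using assms(2)
  proof (cases rule: oriented_4_cycle_cases)
    case (path p q r s)
    obtain f :: "'a \<Rightarrow> nat" where f: "\<And>v. f v < 3"
        "\<And>u v. u \<in> uverts G \<Longrightarrow> v \<in> uverts G \<Longrightarrow> {u, v} \<in> uedges G \<Longrightarrow> f u \<noteq> f v"
      using ex_3_colouring[OF fin card_edge deg] by blast
    define A where "A = {(u, v). {u, v} \<in> uedges G \<and> f u < f v}"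
    have "orients (uedges G) (uverts G) A"
      using assms(1) f(2) unfolding orients_def A_def fin_simple_graph_def
      by (fastforce simp: insert_commute neq_iff)
    moreover have "\<not> contains_copy \<lparr>dverts = uverts G, darcs = A\<rparr> C"
    proof
      assume "contains_copy \<lparr>dverts = uverts G, darcs = A\<rparr> C"
      then obtain g where "(g p, g q) \<in> A" "(g q, g r) \<in> A" "(g r, g s) \<in> A"
        using path by (elim contains_copyE) auto
      then have "f (g p) < f (g q)" "f (g q) < f (g r)" "f (g r) < f (g s)"
        by (auto simp: A_def)
      \<comment> \<open>Three strict increases from a natural number force \<open>f (g s)\<close> to
        be at least 3.\<close>
      with f(1)[of "g s"] show False
        by linarith
    qed
    ultimately show ?thesis
      using is_orientation_of_orients[OF assms(1)] by blast
  next
    case (parallel a b c d)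
    obtain A where A: "orients (uedges G) (uverts G) A" "\<And>a b c d. \<not> parallel_paths A a b c d"
      using ex_orients_without_parallel_paths[OF fin card_edge deg] by blast
    have "\<not> contains_copy \<lparr>dverts = uverts G, darcs = A\<rparr> C"
    proof
      assume "contains_copy \<lparr>dverts = uverts G, darcs = A\<rparr> C"
      then obtain g where g: "inj_on g (dverts C)" "\<And>u v. u \<in> dverts C \<Longrightarrow> v \<in> dverts C \<Longrightarrow>
          (u, v) \<in> darcs C \<Longrightarrow> (g u, g v) \<in> A"
        by (elim contains_copyE) auto
      \<comment> \<open>Injectivity of \<open>g\<close> carries \<open>b \<noteq> d\<close> over to
        the images.\<close>
      have "parallel_paths A (g a) (g b) (g c) (g d)"
        using parallel g by (auto simp: parallel_paths_def inj_on_eq_iff)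
      with A(2) show False by blast
    qed
    with A(1) show ?thesis
      using is_orientation_of_orients[OF assms(1)] by blast
  next
    case (alternating a b c d)
    obtain A where A: "orients (uedges G) (uverts G) A" "\<And>a b c d. \<not> alternating_cycle A a b c d"
      using ex_orients_without_alternating_cycle[OF fin card_edge deg] by blast
    have "\<not> contains_copy \<lparr>dverts = uverts G, darcs = A\<rparr> C"
    proof
      assume "contains_copy \<lparr>dverts = uverts G, darcs = A\<rparr> C"
      then obtain g where g: "inj_on g (dverts C)" "\<And>u v. u \<in> dverts C \<Longrightarrow> v \<in> dverts C \<Longrightarrow>
          (u, v) \<in> darcs C \<Longrightarrow> (g u, g v) \<in> A"
        by (elim contains_copyE) auto
      \<comment> \<open>Injectivity again keeps the two sources, and the two sinks,
        distinct.\<close>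
      have "alternating_cycle A (g a) (g b) (g c) (g d)"
        using alternating g by (auto simp: alternating_cycle_def inj_on_eq_iff)
      with A(2) show False by blast
    qed
    with A(1) show ?thesis
      using is_orientation_of_orients[OF assms(1)] by blast
  qed
  then show ?thesis
    by (auto simp: orientation_arrow_def)
qed

end
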